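(* Every $2$-saturated subcubic graph $G$ such that $g_3(G)=3$ is $(2,2,2,2,2)$-packing colorable.
   Context: All graphs are finite, simple and undirected. For a non-decreasing sequence $S=(s_1,\dots,s_k)$ of positive integers, an $S$-packing coloring of $G$ is a partition of $V(G)$ into sets $V_1,\dots,V_k$ such that any two distinct vertices $u,v\in V_i$ satisfy $dist_G(u,v)>s_i$; $G$ is $S$-packing colorable if it admits one. $G$ is subcubic if its maximum degree is at most $3$. A subcubic graph is $k$-saturated if every vertex of degree $3$ is adjacent to at most $k$ vertices of degree $3$. The local girth $g(v)$ of a vertex $v$ is the length of a shortest cycle containing $v$ ($\infty$ if none), and $g_3(G)=\max\{g(v): d_G(v)=3\}$. *)

theory Defs
  imports
    "Graph_Theory.Graph_Theory"
    "HOL-Library.Extended_Nat"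
    "HOL-Library.Disjoint_Sets"
begin

text \<open>
  Finite simple undirected graphs are modelled by the locale \<open>graph\<close>: finite symmetric digraphs
  without loops and parallel arcs. An edge \<open>uv\<close> is a pair of opposite arcs, so the degree of a
  vertex is its \<open>out_degree\<close>.
\<close>

text \<open>The distance is the minimum number of edges of a walk, and \<open>\<infinity>\<close> between different components.\<close>

definition graph_dist :: "('a, 'b) pre_digraph \<Rightarrow> 'a \<Rightarrow> 'a \<Rightarrow> ereal" where
  "graph_dist G u v = wf_digraph.\<mu> G (\<lambda>_. 1) u v"

text \<open>
  The sequence \<open>S = (s\<^sub>1, \<dots>, s\<^sub>k)\<close> is a list indexed from 0. As usual for colorings, color classes
  may be empty.
\<close>

definition packing_coloring ::
  "('a, 'b) pre_digraph \<Rightarrow> nat list \<Rightarrow> (nat \<Rightarrow> 'a set) \<Rightarrow> bool" where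
  "packing_coloring G S V \<longleftrightarrow>
     (\<Union>i<length S. V i) = verts G \<and>
     disjoint_family_on V {..<length S} \<and>
     (\<forall>i<length S. \<forall>u\<in>V i. \<forall>v\<in>V i. u \<noteq> v \<longrightarrow> graph_dist G u v > ereal (real (S ! i)))"

definition packing_colorable :: "('a, 'b) pre_digraph \<Rightarrow> nat list \<Rightarrow> bool" where
  "packing_colorable G S \<longleftrightarrow> (\<exists>V. packing_coloring G S V)"

definition subcubic :: "('a, 'b) pre_digraph \<Rightarrow> bool" where
  "subcubic G \<longleftrightarrow> (\<forall>v\<in>verts G. out_degree G v \<le> 3)"

definition saturated :: "nat \<Rightarrow> ('a, 'b) pre_digraph \<Rightarrow> bool" where
  "saturated k G \<longleftrightarrow>
     (\<forall>v\<in>verts G. out_degree G v = 3 \<longrightarrow>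
        card {u \<in> verts G. v \<rightarrow>\<^bsub>G\<^esub> u \<and> out_degree G u = 3} \<le> k)"

text \<open>
  A directed cycle of length 2 in the symmetric digraph runs back and forth along a single edge;
  the cycles of the undirected graph are those of length at least 3. The infimum of the empty set
  is \<open>\<infinity>\<close>.
\<close>

definition local_girth :: "('a, 'b) pre_digraph \<Rightarrow> 'a \<Rightarrow> enat" where
  "local_girth G v =
     (INF p \<in> {p. pre_digraph.cycle G p \<and> 3 \<le> length p \<and> v \<in> tail G ` set p}. enat (length p))"

text \<open>
  For a finite graph with a vertex of degree 3 the supremum is a maximum; otherwise it is 0.
\<close>

definition g3 :: "('a, 'b) pre_digraph \<Rightarrow> enat" where
  "g3 G = (SUP v \<in> {v \<in> verts G. out_degree G v = 3}. local_girth G v)"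

end

theory Submission
  imports Defs
begin

text \<open>
  The coloring is a proper 5-coloring of the square of the graph. A vertex of degree at most 2 that
  has at most 4 vertices within distance 2 can be suppressed (deleted, with its neighbors joined) and
  colored last. In a graph without such vertices, the vertices of degree 3 form disjoint triangles,
  each of their vertices having one further neighbor, of degree 2, and these triangles are linked by
  paths with one or two inner vertices. The inner vertices are colored with two colors of their own.
  It remains to color the triangles with three colors such that the ends of a path with one inner
  vertex differ, i.e. to 3-color disjoint triangles plus a matching. This succeeds by induction:
  delete a triangle \<open>abd\<close> and match the former partners of \<open>a\<close> and \<open>b\<close> with each other, so that they
  get different colors; then \<open>a\<close>, \<open>b\<close>, \<open>d\<close> do not all have the same forbidden color.
\<close>

section \<open>3-coloring disjoint triangles plus a matching\<close>

text \<open>\<open>p\<close>, \<open>q\<close>, \<open>r\<close> are the colors forbidden at the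
  corners of a triangle; a value of at least 3 forbids nothing. By Hall's theorem, distinct choices
  fail only if all three corners are left with the same two colors, i.e. if p = q = r < 3. The proof
  checks the six permutations directly.\<close>

lemma three_colors_avoiding:
  fixes p q r :: nat
  assumes "p \<noteq> q \<or> 3 \<le> p"
  shows "\<exists>i j k. i < 3 \<and> j < 3 \<and> k < 3 \<and> i \<noteq> j \<and> i \<noteq> k \<and> j \<noteq> k \<and> i \<noteq> p \<and> j \<noteq> q \<and> k \<noteq> r"
proof (rule ccontr)
  assume none: "\<not> ?thesis"
  have "p = i \<or> q = j \<or> r = k"
    if "i < 3" "j < 3" "k < 3" "i \<noteq> j" "i \<noteq> k" "j \<noteq> k" for i j k
    using none that by blast
  then have "p = 0 \<or> q = 1 \<or> r = 2" "p = 0 \<or> q = 2 \<or> r = 1" "p = 1 \<or> q = 0 \<or> r = 2"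
    "p = 1 \<or> q = 2 \<or> r = 0" "p = 2 \<or> q = 0 \<or> r = 1" "p = 2 \<or> q = 1 \<or> r = 0"
    by simp_all
  then show False
    using assms
    by (cases "p = 0"; cases "p = 1"; cases "p = 2"; cases "q = 0"; cases "q = 1"; cases "q = 2")
      simp_all
qed

text \<open>The triangles are the fibers of \<open>block\<close> on \<open>D\<close>, and
  \<open>M\<close> is a partial matching on \<open>D\<close>. An edge of \<open>M\<close> inside a
  triangle adds no constraint.\<close>

lemma triangles_with_matching_3_colorable:
  fixes D :: "'a set" and block :: "'a \<Rightarrow> 'c" and M :: "'a \<Rightarrow> 'a \<Rightarrow> bool"
  assumes "finite D"
    and "\<And>x. x \<in> D \<Longrightarrow> card {y \<in> D. block y = block x} = 3"
    and "\<And>x y. x \<in> D \<Longrightarrow> y \<in> D \<Longrightarrow> M x y \<Longrightarrow> M y x"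
    and "\<And>x y z. x \<in> D \<Longrightarrow> y \<in> D \<Longrightarrow> z \<in> D \<Longrightarrow> M x y \<Longrightarrow> M x z \<Longrightarrow> y = z"
  shows "\<exists>f :: 'a \<Rightarrow> nat. (\<forall>x\<in>D. f x < 3) \<and>
    (\<forall>x\<in>D. \<forall>y\<in>D. x \<noteq> y \<longrightarrow> block x = block y \<or> M x y \<longrightarrow> f x \<noteq> f y)"
  using assms
proof (induction "card D" arbitrary: D M rule: less_induct)
  case less
  note fin = less.prems(1) and card3 = less.prems(2) and sym = less.prems(3) and fn = less.prems(4)
  show ?case
  proof (cases "D = {}")
    case False
    then obtain x0 where x0: "x0 \<in> D" by blast
    define B where "B = {y \<in> D. block y = block x0}"
    define D' where "D' = D - B"
    have "card B = 3" using card3[OF x0] by (simp add: B_def)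
    then obtain a b d where B: "B = {a, b, d}" and dist: "a \<noteq> b" "a \<noteq> d" "b \<noteq> d"
      by (metis card_3_iff)
    have BD: "a \<in> D" "b \<in> D" "d \<in> D" using B unfolding B_def by blast+
    have D'D: "D' \<subseteq> D" by (auto simp: D'_def)
    have smaller: "card D' < card D"
      using fin B BD by (intro psubset_card_mono) (auto simp: D'_def)
    define M' where "M' x y \<longleftrightarrow> M x y \<or> (M a x \<and> M b y) \<or> (M b x \<and> M a y)" for x y
    have notB: "x \<noteq> a" "x \<noteq> b" "x \<noteq> d" if "x \<in> D'" for x
      using that by (auto simp: D'_def B)
    have blocks: "block x \<noteq> block y" if "x \<in> D'" "y \<in> B" for x y
      using that by (auto simp: D'_def B_def)
    have "\<exists>f :: 'a \<Rightarrow> nat. (\<forall>x\<in>D'. f x < 3) \<and>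
      (\<forall>x\<in>D'. \<forall>y\<in>D'. x \<noteq> y \<longrightarrow> block x = block y \<or> M' x y \<longrightarrow> f x \<noteq> f y)"
    proof (rule less.hyps[OF smaller])
      show "finite D'" using fin by (simp add: D'_def)
    next
      fix x assume x: "x \<in> D'"
      then have "{y \<in> D'. block y = block x} = {y \<in> D. block y = block x}"
        by (auto simp: D'_def B_def)
      then show "card {y \<in> D'. block y = block x} = 3" using card3 x D'D by auto
    next
      fix x y assume "x \<in> D'" "y \<in> D'" "M' x y"
      then show "M' y x" using sym D'D by (auto simp: M'_def)
    next
      fix x y z assume xyz: "x \<in> D'" "y \<in> D'" "z \<in> D'" and M': "M' x y" "M' x z"
      \<comment> \<open>\<open>M'\<close> remains a matching: a partner of a deleted vertex has no
        further partner in \<open>D'\<close>, and no vertex is the partner of both \<open>a\<close>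
        and \<open>b\<close>.\<close>
      have *: "M s x \<Longrightarrow> M x t \<Longrightarrow> s \<in> B \<Longrightarrow> t \<in> D' \<Longrightarrow> False" for s t
        using fn[of x s t] sym[of s x] xyz D'D notB BD B by blast
      have **: "M a x \<Longrightarrow> M b x \<Longrightarrow> False"
        using fn[of x a b] sym[of a x] sym[of b x] xyz D'D BD dist by blast
      show "y = z"
        using M' * ** fn xyz D'D BD unfolding M'_def B by blast
    qed
    then obtain f :: "'a \<Rightarrow> nat" where f3: "\<And>x. x \<in> D' \<Longrightarrow> f x < 3"
      and f: "\<And>x y. x \<in> D' \<Longrightarrow> y \<in> D' \<Longrightarrow> x \<noteq> y \<Longrightarrow> block x = block y \<or> M' x y \<Longrightarrow> f x \<noteq> f y"
      by blast
    \<comment> \<open>The color forbidden for \<open>x\<close>; 3 stands for none.\<close>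
    define c where "c x = (if \<exists>y\<in>D'. M x y then f (SOME y. y \<in> D' \<and> M x y) else 3)" for x
    have c: "c x = f y" if "x \<in> B" "y \<in> D'" "M x y" for x y
    proof -
      have "(SOME y. y \<in> D' \<and> M x y) = y"
        using that fn D'D BD B by (intro some_equality) blast+
      then show ?thesis using that by (auto simp: c_def)
    qed
    have "c a \<noteq> c b \<or> 3 \<le> c a"
    proof (cases "(\<exists>y\<in>D'. M a y) \<and> (\<exists>y\<in>D'. M b y)")
      case True
      then obtain y z where yz: "y \<in> D'" "M a y" "z \<in> D'" "M b z" by blast
      \<comment> \<open>The partners of \<open>a\<close> and \<open>b\<close> are distinct and
        joined by \<open>M'\<close>, so the induction hypothesis separates their colors.\<close>
      then have "y \<noteq> z" using fn[of y a b] sym BD D'D dist by blast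
      then have "f y \<noteq> f z" using f yz by (auto simp: M'_def)
      then show ?thesis using yz c B by auto
    next
      case False
      \<comment> \<open>If \<open>a\<close> has no partner in \<open>D'\<close>, then
        \<open>c a\<close> is 3. Otherwise \<open>b\<close> has none, and \<open>c b\<close> is 3
        while \<open>c a\<close> is a real color.\<close>
      moreover have "c a < 3" if "\<exists>y\<in>D'. M a y" using that c[of a] f3 B by auto
      ultimately show ?thesis by (auto simp: c_def)
    qed
    from three_colors_avoiding[OF this, of "c d"] obtain i j k where
      ijk: "i < 3" "j < 3" "k < 3" "i \<noteq> j" "i \<noteq> k" "j \<noteq> k" "i \<noteq> c a" "j \<noteq> c b" "k \<noteq> c d"
      by blast
    define g where "g = f(a := i, b := j, d := k)"
    have gB: "g a = i" "g b = j" "g d = k" using dist by (auto simp: g_def)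
    have gD': "g x = f x" if "x \<in> D'" for x using notB[OF that] by (simp add: g_def)
    have out: "g x \<noteq> g y" if "x \<in> B" "y \<in> D'" "M x y" for x y
      using c[OF that] that ijk gB gD'[of y] unfolding B by auto
    have split: "x \<in> B \<or> x \<in> D'" if "x \<in> D" for x using that by (auto simp: D'_def)
    have BB: "g x \<noteq> g y" if "x \<in> B" "y \<in> B" "x \<noteq> y" for x y
      using that gB ijk unfolding B by auto
    have "g x < 3" if "x \<in> D" for x
      using split[OF that] gB gD' f3 ijk unfolding B by auto
    moreover have "g x \<noteq> g y" if xy: "x \<in> D" "y \<in> D" "x \<noteq> y" "block x = block y \<or> M x y" for x y
    proof -
      consider "x \<in> B" "y \<in> B" | "x \<in> B" "y \<in> D'" | "x \<in> D'" "y \<in> B" | "x \<in> D'" "y \<in> D'"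
        using split xy by blast
      then show ?thesis
      proof cases
        case 1 then show ?thesis using BB xy by blast
      next
        case 2 then show ?thesis using out blocks[of y x] xy by auto
      next
        case 3 then show ?thesis using out[of y x] blocks[of x y] xy sym[of x y] by auto
      next
        case 4 then show ?thesis using f[of x y] xy gD' by (auto simp: M'_def)
      qed
    qed
    ultimately show ?thesis by blast
  qed auto
qed

section \<open>Square colorings of graphs given as relations\<close>

abbreviation nbrs :: "('a \<Rightarrow> 'a \<Rightarrow> bool) \<Rightarrow> 'a \<Rightarrow> 'a set" where
  "nbrs E v \<equiv> {u. E v u}"

text \<open>Edges form a plain relation, so that suppression can add an edge without constructing
  new arcs.\<close>

definition square_colorable :: "'a set \<Rightarrow> ('a \<Rightarrow> 'a \<Rightarrow> bool) \<Rightarrow> nat \<Rightarrow> bool" where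
  "square_colorable V E k \<longleftrightarrow> (\<exists>f :: 'a \<Rightarrow> nat. (\<forall>v\<in>V. f v < k) \<and>
     (\<forall>u\<in>V. \<forall>v\<in>V. u \<noteq> v \<longrightarrow> E u v \<or> (\<exists>w. E u w \<and> E w v) \<longrightarrow> f u \<noteq> f v))"

lemma square_colorableE:
  assumes "square_colorable V E k"
  obtains f :: "'a \<Rightarrow> nat" where "\<And>v. v \<in> V \<Longrightarrow> f v < k"
    and "\<And>u v. u \<in> V \<Longrightarrow> v \<in> V \<Longrightarrow> u \<noteq> v \<Longrightarrow> E u v \<or> (\<exists>w. E u w \<and> E w v) \<Longrightarrow> f u \<noteq> f v"
  using assms unfolding square_colorable_def by blast

text \<open>
  Since a vertex of degree 3 has at most 3 neighbors of degree 3, being 2-saturated means that one of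
  its neighbors has another degree.
\<close>

locale triangular_graph =
  fixes V :: "'a set" and E :: "'a \<Rightarrow> 'a \<Rightarrow> bool"
  assumes finite_V: "finite V"
    and E_in_V: "E u v \<Longrightarrow> u \<in> V"
    and E_sym: "E u v \<Longrightarrow> E v u"
    and E_irrefl: "\<not> E v v"
    and deg_le_3: "card (nbrs E v) \<le> 3"
    and triangle: "card (nbrs E v) = 3 \<Longrightarrow> \<exists>x y. E v x \<and> E v y \<and> E x y"
    and unsaturated: "card (nbrs E v) = 3 \<Longrightarrow> \<exists>u. E v u \<and> card (nbrs E u) \<noteq> 3"
begin

lemma nbrs_subset: "nbrs E v \<subseteq> V"
  using E_in_V E_sym by blast

lemma finite_nbrs [simp]: "finite (nbrs E v)"
  using finite_subset[OF nbrs_subset finite_V] .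

section \<open>Suppressing a vertex\<close>

definition suppress :: "'a \<Rightarrow> 'a \<Rightarrow> 'a \<Rightarrow> bool" where
  "suppress v x y \<longleftrightarrow> x \<noteq> v \<and> y \<noteq> v \<and> x \<noteq> y \<and> (E x y \<or> E x v \<and> E v y)"

text \<open>The second condition ensures that suppressing \<open>v\<close> lowers the degree of its neighbors of degree 3.\<close>

definition suppressible :: "'a \<Rightarrow> bool" where
  "suppressible v \<longleftrightarrow> card (nbrs E v) \<le> 2 \<and>
     (\<forall>x. E v x \<longrightarrow> card (nbrs E x) = 3 \<longrightarrow> nbrs E v - {x} \<subseteq> nbrs E x)"

lemma nbrs_suppress_non_nbr:
  assumes "\<not> E x v" "x \<noteq> v"
  shows "nbrs (suppress v) x = nbrs E x"
  using assms E_irrefl by (auto simp: suppress_def)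

text \<open>The vertex \<open>x\<close> loses \<open>v\<close> and gains at most the other neighbor
  of \<open>v\<close>, so its degree does not grow. If the degree was 3, suppressibility says that
  this other neighbor was already adjacent to \<open>x\<close>, so nothing is gained.\<close>

lemma card_nbrs_suppress_nbr:
  assumes v: "suppressible v" and x: "E x v"
  shows "card (nbrs (suppress v) x) \<le> card (nbrs E x)"
    and "card (nbrs (suppress v) x) < 3"
proof -
  have vx: "E v x" using x E_sym by blast
  have sub: "nbrs (suppress v) x \<subseteq> (nbrs E x - {v}) \<union> (nbrs E v - {x})"
    by (auto simp: suppress_def)
  have "card (nbrs E v - {x}) \<le> 1"
    using v vx by (auto simp: suppressible_def card_Diff_singleton)
  moreover have cx: "card (nbrs E x - {v}) = card (nbrs E x) - 1"
    using x by (simp add: card_Diff_singleton)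
  moreover have pos: "card (nbrs E x) > 0" using x by (auto simp: card_gt_0_iff)
  ultimately have le: "card ((nbrs E x - {v}) \<union> (nbrs E v - {x})) \<le> card (nbrs E x)"
    using card_Un_le[of "nbrs E x - {v}" "nbrs E v - {x}"] by linarith
  show 1: "card (nbrs (suppress v) x) \<le> card (nbrs E x)"
    using card_mono[OF _ sub] le by simp
  show "card (nbrs (suppress v) x) < 3"
  proof (cases "card (nbrs E x) = 3")
    case True
    then have "nbrs E v - {x} \<subseteq> nbrs E x - {v}"
      using v vx E_irrefl by (auto simp: suppressible_def)
    then have "nbrs (suppress v) x \<subseteq> nbrs E x - {v}" using sub by blast
    then have "card (nbrs (suppress v) x) \<le> card (nbrs E x - {v})"
      by (intro card_mono) auto
    then show ?thesis using cx True by simp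
  next
    case False
    then show ?thesis using 1 deg_le_3[of x] by linarith
  qed
qed

text \<open>A vertex of degree 3 after suppression was neither \<open>v\<close> nor a neighbor of
  \<open>v\<close>. It keeps its neighbors, and its triangle avoids \<open>v\<close> and survives.
  Its neighbor of degree below 3 stays below 3, as no degree increases.\<close>

lemma triangular_graph_suppress:
  assumes v: "suppressible v"
  shows "triangular_graph (V - {v}) (suppress v)"
proof -
  have self: "nbrs (suppress v) v = {}" by (auto simp: suppress_def)
  have le: "card (nbrs (suppress v) x) \<le> card (nbrs E x)" for x
    using card_nbrs_suppress_nbr(1)[OF v, of x] nbrs_suppress_non_nbr[of x v] self
    by (cases "x = v"; cases "E x v") auto
  have cubic: "\<not> E x v \<and> x \<noteq> v" if "card (nbrs (suppress v) x) = 3" for x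
    using that card_nbrs_suppress_nbr(2)[OF v, of x] self by auto
  show ?thesis
  proof
    show "finite (V - {v})" using finite_V by simp
  next
    fix x y assume "suppress v x y"
    then show "x \<in> V - {v}" "suppress v y x"
      using E_in_V E_sym by (auto simp: suppress_def)
  next
    fix x show "\<not> suppress v x x" by (simp add: suppress_def)
    show "card (nbrs (suppress v) x) \<le> 3" using le[of x] deg_le_3[of x] by linarith
  next
    fix x assume "card (nbrs (suppress v) x) = 3"
    then have x: "\<not> E x v" "x \<noteq> v" and c: "card (nbrs E x) = 3"
      using cubic nbrs_suppress_non_nbr by metis+
    obtain y z where "E x y" "E x z" "E y z" using triangle[OF c] by blast
    then show "\<exists>y z. suppress v x y \<and> suppress v x z \<and> suppress v y z"
      using x E_irrefl by (intro exI[of _ y] exI[of _ z]) (auto simp: suppress_def)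
    obtain u where u: "E x u" "card (nbrs E u) \<noteq> 3" using unsaturated[OF c] by blast
    then have "suppress v x u" using x E_irrefl by (auto simp: suppress_def)
    moreover have "card (nbrs (suppress v) u) \<noteq> 3" using le[of u] u deg_le_3[of u] by linarith
    ultimately show "\<exists>u. suppress v x u \<and> card (nbrs (suppress v) u) \<noteq> 3" by blast
  qed
qed

text \<open>Each neighbor \<open>x\<close> of \<open>v\<close> accounts for itself and its neighbors
  outside \<open>v\<close> and \<open>nbrs E v\<close>. A single neighbor accounts for at most 3
  vertices. If there are two, each accounts for at most 2: it has degree at most 2, or it has degree
  3 and one of its edges goes to the other neighbor.\<close>

lemma card_second_nbrs_suppressible:
  assumes v: "suppressible v"
  shows "card {u. u \<noteq> v \<and> (E u v \<or> (\<exists>w. E u w \<and> E w v))} \<le> 4" (is "card ?N \<le> 4")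
proof -
  define A where "A x = insert x (nbrs E x - {v} - nbrs E v)" for x
  have N: "?N \<subseteq> (\<Union>x\<in>nbrs E v. A x)"
    using E_sym by (auto simp: A_def)
  have finA: "finite (A x)" for x by (simp add: A_def)
  have A3: "card (A x) \<le> 3" if "E v x" for x
  proof -
    have "card (nbrs E x - {v} - nbrs E v) \<le> card (nbrs E x - {v})"
      by (intro card_mono) auto
    also have "\<dots> \<le> 2" using deg_le_3[of x] E_sym[OF that] by (simp add: card_Diff_singleton)
    finally show ?thesis by (simp add: A_def card_insert_if)
  qed
  have A2: "card (A x) \<le> 2" if "E v x" "E v y" "x \<noteq> y" for x y
  proof -
    have "card (nbrs E x - {v} - nbrs E v) \<le> 1"
    proof (cases "card (nbrs E x) = 3")
      case True
      then have xy: "E x y" using v that by (auto simp: suppressible_def)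
      have "y \<noteq> v" using that E_irrefl by auto
      have "card (nbrs E x - {v} - nbrs E v) \<le> card (nbrs E x - {v} - {y})"
        using that by (intro card_mono) auto
      also have "\<dots> = 1" using True xy E_sym[OF that(1)] \<open>y \<noteq> v\<close>
        by (simp add: card_Diff_singleton)
      finally show ?thesis .
    next
      case False
      have "card (nbrs E x - {v} - nbrs E v) \<le> card (nbrs E x - {v})"
        by (intro card_mono) auto
      also have "\<dots> \<le> 1"
        using False deg_le_3[of x] E_sym[OF that(1)] by (simp add: card_Diff_singleton)
      finally show ?thesis .
    qed
    then show ?thesis by (simp add: A_def card_insert_if)
  qed
  have "card ?N \<le> card (\<Union>x\<in>nbrs E v. A x)" using N finA by (intro card_mono) auto
  also have "\<dots> \<le> (\<Sum>x\<in>nbrs E v. card (A x))" by (intro card_UN_le) simp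
  also have "\<dots> \<le> 4"
  proof (cases "card (nbrs E v) = 2")
    case True
    then obtain x y where xy: "nbrs E v = {x, y}" "x \<noteq> y" by (metis card_2_iff)
    then have "E v x" "E v y" by auto
    then have "card (A x) \<le> 2" "card (A y) \<le> 2" using A2[of x y] A2[of y x] xy(2) by auto
    then show ?thesis using xy by simp
  next
    case False
    then have "card (nbrs E v) \<le> 1" using v by (simp add: suppressible_def)
    then show ?thesis using sum_bounded_above[of "nbrs E v" "\<lambda>x. card (A x)" 3] A3 by simp
  qed
  finally show ?thesis .
qed

lemma square_colorable_suppress:
  assumes v: "suppressible v" and col: "square_colorable (V - {v}) (suppress v) 5"
  shows "square_colorable V E 5"
proof -
  define N where "N = {u. u \<noteq> v \<and> (E u v \<or> (\<exists>w. E u w \<and> E w v))}"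
  have "N \<subseteq> V" using E_in_V by (auto simp: N_def)
  then have finN: "finite N" using finite_V finite_subset by blast
  obtain f :: "'a \<Rightarrow> nat" where f5: "\<And>x. x \<in> V - {v} \<Longrightarrow> f x < 5"
    and f: "\<And>x y. x \<in> V - {v} \<Longrightarrow> y \<in> V - {v} \<Longrightarrow> x \<noteq> y \<Longrightarrow>
      suppress v x y \<or> (\<exists>w. suppress v x w \<and> suppress v w y) \<Longrightarrow> f x \<noteq> f y"
    by (fact square_colorableE[OF col])
  have "card (f ` N) \<le> 4"
    using card_image_le[OF finN, of f] card_second_nbrs_suppressible[OF v] by (simp add: N_def)
  then have "\<not> {..<5} \<subseteq> f ` N" using card_mono[of "f ` N" "{..<5}"] finN by auto
  then obtain c where c: "c < 5" "c \<notin> f ` N" by blast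
  define g where "g = f(v := c)"
  have "g x < 5" if "x \<in> V" for x using that f5 c by (simp add: g_def)
  moreover have "g x \<noteq> g y"
    if xy: "x \<in> V" "y \<in> V" "x \<noteq> y" "E x y \<or> (\<exists>w. E x w \<and> E w y)" for x y
  proof -
    have near: "E y x \<or> (\<exists>w. E y w \<and> E w x)" using xy E_sym by blast
    consider "x = v" | "y = v" | "x \<noteq> v" "y \<noteq> v" by blast
    then show ?thesis
    proof cases
      case 1
      then have "y \<in> N" using near xy by (auto simp: N_def)
      then show ?thesis using 1 xy c by (auto simp: g_def)
    next
      case 2
      then have "x \<in> N" using xy by (auto simp: N_def)
      then show ?thesis using 2 xy c by (auto simp: g_def)
    next
      case 3
      \<comment> \<open>A path from \<open>x\<close> to \<open>y\<close> through \<open>v\<close>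
        has become an edge; a path of length at most 2 avoiding \<open>v\<close> is
        unchanged.\<close>
      have "suppress v x y \<or> (\<exists>w. suppress v x w \<and> suppress v w y)"
        using xy 3 E_irrefl unfolding suppress_def by metis
      then show ?thesis using f xy 3 by (simp add: g_def)
    qed
  qed
  ultimately show ?thesis unfolding square_colorable_def by blast
qed

section \<open>Graphs without suppressible vertices\<close>

lemma square_colorable_irreducible:
  assumes irr: "\<And>v. v \<in> V \<Longrightarrow> \<not> suppressible v"
  shows "square_colorable V E 5"
proof -
  define D where "D = {v. card (nbrs E v) = 3}"
  have DV: "D \<subseteq> V" using E_in_V triangle unfolding D_def by blast
  then have finD: "finite D" using finite_V finite_subset by blast
  \<comment> \<open>Since \<open>v\<close> has degree at most 2, it fails to be suppressible only
    through a neighbor of degree 3 that is not adjacent to a second neighbor of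
    \<open>v\<close>.\<close>
  have thread: "\<exists>x y. (\<forall>w. E v w \<longleftrightarrow> w = x \<or> w = y) \<and> x \<noteq> y \<and> \<not> E x y \<and> x \<in> D" if v: "v \<in> V" "v \<notin> D" for v
  proof -
    have c: "card (nbrs E v) \<le> 2" using v deg_le_3[of v] by (simp add: D_def)
    then obtain x y where xy: "E v x" "E v y" "x \<noteq> y" "\<not> E x y" "x \<in> D"
      using irr[OF v(1)] by (auto simp: suppressible_def D_def)
    then have "nbrs E v = {x, y}"
      using c by (intro card_seteq[symmetric]) auto
    then have "\<forall>w. E v w \<longleftrightarrow> w = x \<or> w = y" by auto
    then show ?thesis using xy by blast
  qed
  have thread_no_triangle: False if v: "E v x" "E v y" "E x y" "v \<notin> D" for v x y
  proof -
    obtain x' y' where *: "\<And>w. E v w \<longleftrightarrow> w = x' \<or> w = y'" "\<not> E x' y'" using thread[of v] v E_in_V by blast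
    then have "(x = x' \<or> x = y') \<and> (y = x' \<or> y = y')" using v by simp
    then show False using v(3) *(2) E_irrefl E_sym[OF v(3)] by auto
  qed
  \<comment> \<open>The triangle at \<open>x\<close> lies in \<open>D\<close>, because a vertex
    outside \<open>D\<close> is in no triangle; the third neighbor \<open>p\<close> is the one of
    degree other than 3.\<close>
  have cubic: "\<exists>y z p. (\<forall>w. E x w \<longleftrightarrow> w = y \<or> w = z \<or> w = p) \<and> y \<noteq> z \<and> E y z \<and> y \<in> D \<and> z \<in> D \<and> p \<notin> D" if x: "x \<in> D" for x
  proof -
    obtain y z where yz: "E x y" "E x z" "E y z" using triangle x unfolding D_def by blast
    then have D: "y \<in> D" "z \<in> D" using thread_no_triangle E_sym by blast+
    obtain p where p: "E x p" "p \<notin> D" using unsaturated x unfolding D_def by blast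
    have "y \<noteq> z" using yz E_irrefl by auto
    moreover have "y \<noteq> p" "z \<noteq> p" using D p by blast+
    ultimately have "card {y, z, p} = 3" by simp
    then have "nbrs E x = {y, z, p}"
      using x yz p by (intro card_seteq[symmetric]) (auto simp: D_def)
    then have "\<forall>w. E x w \<longleftrightarrow> w = y \<or> w = z \<or> w = p" by auto
    then show ?thesis using D p yz \<open>y \<noteq> z\<close> by blast
  qed
  have port_unique: "p = q" if "x \<in> D" "E x p" "E x q" "p \<notin> D" "q \<notin> D" for x p q
    using cubic[OF that(1)] that by metis
  \<comment> \<open>The triangle containing \<open>x\<close>, as a set; it serves as its own
    label.\<close>
  define block where "block x = insert x (nbrs E x \<inter> D)" for x
  have block_nbr: "E y z" if "x \<in> D" "E x y" "E x z" "y \<in> D" "z \<in> D" "y \<noteq> z" for x y z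
    using cubic[OF that(1)] that E_sym by metis
  have block_sub: "block x \<subseteq> block y" if "x \<in> D" "y \<in> D" "E x y" for x y
    using that block_nbr[of x y] E_sym[of x y] unfolding block_def by auto
  have block_eq: "block x = block y" if "x \<in> D" "y \<in> D" "E x y" for x y
    using block_sub[OF that] block_sub[OF that(2,1) E_sym[OF that(3)]] by (rule subset_antisym)
  have block_class: "{y \<in> D. block y = block x} = block x" if "x \<in> D" for x
  proof (intro equalityI subsetI)
    fix y assume "y \<in> {y \<in> D. block y = block x}"
    then show "y \<in> block x" by (auto simp: block_def)
  next
    fix y assume "y \<in> block x"
    then have "y = x \<or> y \<in> D \<and> E x y" by (auto simp: block_def)
    then show "y \<in> {y \<in> D. block y = block x}" using that block_eq[of x y] by auto
  qed
  have card_block: "card (block x) = 3" if x: "x \<in> D" for x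
  proof -
    obtain y z p where *: "\<And>w. E x w \<longleftrightarrow> w = y \<or> w = z \<or> w = p" "y \<noteq> z" "y \<in> D" "z \<in> D" "p \<notin> D"
      using cubic[OF x] by blast
    then have "block x = {x, y, z}" by (auto simp: block_def)
    moreover have "x \<noteq> y" "x \<noteq> z" using * E_irrefl by blast+
    ultimately show ?thesis using * by simp
  qed
  \<comment> \<open>\<open>M\<close> joins the ends of the paths with one inner vertex
    \<open>w\<close>. On \<open>D\<close> it is a matching: \<open>x\<close> has only one neighbor
    outside \<open>D\<close>, and that neighbor has only one neighbor besides
    \<open>x\<close>.\<close>
  define M where "M x y \<longleftrightarrow> x \<noteq> y \<and> (\<exists>w. w \<notin> D \<and> E x w \<and> E w y)" for x y
  have Msym: "M y x" if "M x y" for x y using that E_sym by (auto simp: M_def)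
  have Mfun: "y = z" if M: "x \<in> D" "M x y" "M x z" for x y z
  proof -
    obtain w where w: "w \<notin> D" "E x w" "E w y" "E w z"
      using M port_unique unfolding M_def by metis
    then obtain s t where st: "\<And>u. E w u \<longleftrightarrow> u = s \<or> u = t" using thread[of w] E_in_V by blast
    have "E w x" using w E_sym by blast
    then show ?thesis using M w st by (auto simp: M_def)
  qed
  have "\<exists>f :: 'a \<Rightarrow> nat. (\<forall>x\<in>D. f x < 3) \<and>
    (\<forall>x\<in>D. \<forall>y\<in>D. x \<noteq> y \<longrightarrow> block x = block y \<or> M x y \<longrightarrow> f x \<noteq> f y)"
    by (rule triangles_with_matching_3_colorable) (use finD block_class card_block Msym Mfun in auto)
  then obtain f :: "'a \<Rightarrow> nat" where f3: "\<And>x. x \<in> D \<Longrightarrow> f x < 3"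
    and f: "\<And>x y. x \<in> D \<Longrightarrow> y \<in> D \<Longrightarrow> x \<noteq> y \<Longrightarrow> block x = block y \<or> M x y \<Longrightarrow> f x \<noteq> f y"
    by blast
  obtain h :: "'a \<Rightarrow> nat" where h: "inj_on h V"
    using finite_imp_inj_to_nat_seg[OF finite_V] by blast
  \<comment> \<open>Colors 3 and 4 are reserved for inner vertices. The injective numbering
    \<open>h\<close> breaks the symmetry between two adjacent inner vertices: the smaller one gets
    3, the larger 4. An inner vertex alone on its path gets 4.\<close>
  define g where "g x = (if x \<in> D then f x else if \<exists>y. E x y \<and> y \<notin> D \<and> h x < h y then 3 else 4)" for x
  have thread_nbr_unique: "y = z" if "v \<notin> D" "E v y" "E v z" "y \<notin> D" "z \<notin> D" for v y z
    using thread[of v] that E_in_V by metis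
  have "g x < 5" for x using f3[of x] by (auto simp: g_def)
  moreover have "g x \<noteq> g y"
    if xy: "x \<in> V" "y \<in> V" "x \<noteq> y" "E x y \<or> (\<exists>w. E x w \<and> E w y)" for x y
  proof -
    consider "x \<in> D" "y \<in> D" | "x \<in> D" "y \<notin> D" | "x \<notin> D" "y \<in> D" | "x \<notin> D" "y \<notin> D" by blast
    then show ?thesis
    proof cases
      case 1
      have "block x = block y \<or> M x y"
      proof (cases "E x y")
        case False
        then obtain w where w: "E x w" "E w y" using xy by blast
        \<comment> \<open>A common neighbor in \<open>D\<close> would put \<open>x\<close> and
          \<open>y\<close> into one triangle and make them adjacent.\<close>
        then have "w \<notin> D" using block_nbr[of w x y] 1 xy(3) False E_sym by blast
        then show ?thesis using w xy by (auto simp: M_def)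
      qed (use block_eq 1 in blast)
      then show ?thesis using f 1 xy by (simp add: g_def)
    next
      case 2 then show ?thesis using f3[of x] by (auto simp: g_def)
    next
      case 3 then show ?thesis using f3[of y] by (auto simp: g_def)
    next
      case 4
      \<comment> \<open>No vertex has two neighbors outside \<open>D\<close>, so two distinct
        vertices outside \<open>D\<close> have no common neighbor.\<close>
      have e: "E x y"
        using xy 4 port_unique thread_nbr_unique E_sym by metis
      have "h x \<noteq> h y" using h xy by (auto dest: inj_onD)
      moreover have "(\<exists>z. E x z \<and> z \<notin> D \<and> h x < h z) \<longleftrightarrow> h x < h y"
        using e 4 thread_nbr_unique[of x y] by blast
      moreover have "(\<exists>z. E y z \<and> z \<notin> D \<and> h y < h z) \<longleftrightarrow> h y < h x"
        using E_sym[OF e] 4 thread_nbr_unique[of y x] by blast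
      ultimately show ?thesis using 4 by (auto simp: g_def)
    qed
  qed
  ultimately show ?thesis unfolding square_colorable_def by blast
qed

end

lemma triangular_graph_square_colorable:
  assumes "triangular_graph V E"
  shows "square_colorable V E 5"
  using assms
proof (induction "card V" arbitrary: V E rule: less_induct)
  case less
  interpret triangular_graph V E by (rule less.prems)
  show ?case
  proof (cases "\<exists>v\<in>V. suppressible v")
    case True
    then obtain v where v: "v \<in> V" "suppressible v" by blast
    then have "square_colorable (V - {v}) (suppress v) 5"
      using finite_V by (intro less.hyps triangular_graph_suppress) (auto simp del: card_Diff_insert intro: card_Diff1_less)
    then show ?thesis by (rule square_colorable_suppress[OF v(2)])
  next
    case False
    then show ?thesis by (intro square_colorable_irreducible) blast
  qed
qed

section \<open>Transfer to packing colorings of digraphs\<close>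

context graph
begin

text \<open>Without parallel arcs, \<open>head G\<close> is injective on the arcs leaving
  \<open>v\<close>.\<close>

lemma out_degree_eq_card_nbrs: "out_degree G v = card (nbrs (\<lambda>u w. u \<rightarrow>\<^bsub>G\<^esub> w) v)"
proof -
  have "bij_betw (head G) (out_arcs G v) (nbrs (\<lambda>u w. u \<rightarrow>\<^bsub>G\<^esub> w) v)"
    unfolding bij_betw_def inj_on_def
    using no_multi_arcs by (auto simp: arcs_ends_conv arc_to_ends_def image_iff)
  then show ?thesis by (simp add: out_degree_def bij_betw_same_card)
qed

lemma local_girth_le_3_imp_triangle:
  assumes "local_girth G v \<le> 3"
  shows "\<exists>x y. v \<rightarrow>\<^bsub>G\<^esub> x \<and> v \<rightarrow>\<^bsub>G\<^esub> y \<and> x \<rightarrow>\<^bsub>G\<^esub> y"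
proof -
  \<comment> \<open>A strict bound on an infimum yields a member below it, here a cycle of length
    exactly 3.\<close>
  have "local_girth G v < 4" using assms by (rule le_less_trans) simp
  then obtain p where p: "cycle p" "3 \<le> length p" "v \<in> tail G ` set p" "enat (length p) < 4"
    unfolding local_girth_def by (auto simp: INF_less_iff)
  then have "length p = 3" by (simp add: numeral_eq_enat)
  then obtain a b c where abc: "p = [a, b, c]" by (auto simp: numeral_3_eq_3 length_Suc_conv)
  obtain u where "awalk u p u" using p by (auto simp: cycle_def)
  then have "a \<in> arcs G" "b \<in> arcs G" "c \<in> arcs G"
    "head G a = tail G b" "head G b = tail G c" "head G c = tail G a"
    by (auto simp: abc awalk_simps)
  then have "tail G a \<rightarrow>\<^bsub>G\<^esub> tail G b" "tail G b \<rightarrow>\<^bsub>G\<^esub> tail G c" "tail G c \<rightarrow>\<^bsub>G\<^esub> tail G a"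
    by (metis in_arcs_imp_in_arcs_ends)+
  moreover from this have "tail G b \<rightarrow>\<^bsub>G\<^esub> tail G a" "tail G c \<rightarrow>\<^bsub>G\<^esub> tail G b" "tail G a \<rightarrow>\<^bsub>G\<^esub> tail G c"
    using graph_symmetric by blast+
  ultimately show ?thesis using p(3) by (auto simp: abc)
qed

lemma graph_dist_gt_2:
  assumes "u \<noteq> v" "\<not> u \<rightarrow>\<^bsub>G\<^esub> v" "\<And>w. u \<rightarrow>\<^bsub>G\<^esub> w \<Longrightarrow> \<not> w \<rightarrow>\<^bsub>G\<^esub> v"
  shows "graph_dist G u v > 2"
proof -
  \<comment> \<open>An infimum of values above 2 could still equal 2, so the bound 3 is shown for
    every walk.\<close>
  have "3 \<le> awalk_cost (\<lambda>_. 1) p" if "awalk u p v" for p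
  proof -
    have "3 \<le> length p"
    proof (rule ccontr)
      assume "\<not> 3 \<le> length p"
      then consider "p = []" | a where "p = [a]" | a b where "p = [a, b]"
        by (cases p rule: remdups_adj.cases) (auto simp: Suc_le_eq numeral_3_eq_3)
      then show False
        using that assms by cases (force simp: awalk_simps dest: in_arcs_imp_in_arcs_ends)+
    qed
    then show ?thesis by (simp add: awalk_cost_def sum_list_triv)
  qed
  then have "3 \<le> graph_dist G u v"
    unfolding graph_dist_def \<mu>_def by (intro INF_greatest) auto
  then show ?thesis by (rule less_le_trans[rotated]) simp
qed

lemma square_colorable_imp_packing_colorable:
  assumes "square_colorable (verts G) (\<lambda>u v. u \<rightarrow>\<^bsub>G\<^esub> v) k"
  shows "packing_colorable G (replicate k 2)"
proof -
  obtain f :: "'a \<Rightarrow> nat" where fk: "\<And>v. v \<in> verts G \<Longrightarrow> f v < k"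
    and f: "\<And>u v. u \<in> verts G \<Longrightarrow> v \<in> verts G \<Longrightarrow> u \<noteq> v \<Longrightarrow>
      u \<rightarrow>\<^bsub>G\<^esub> v \<or> (\<exists>w. u \<rightarrow>\<^bsub>G\<^esub> w \<and> w \<rightarrow>\<^bsub>G\<^esub> v) \<Longrightarrow> f u \<noteq> f v"
    by (fact square_colorableE[OF assms])
  have "graph_dist G u v > 2" if "u \<in> verts G" "v \<in> verts G" "u \<noteq> v" "f u = f v" for u v
    using f[of u v] that by (intro graph_dist_gt_2) blast+
  then have "packing_coloring G (replicate k 2) (\<lambda>i. {v \<in> verts G. f v = i})"
    unfolding packing_coloring_def disjoint_family_on_def using fk by auto
  then show ?thesis unfolding packing_colorable_def by blast
qed

end

theorem theorem5:
  fixes G :: "('a, 'b) pre_digraph"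
  assumes "graph G"
    and "subcubic G"
    and "saturated 2 G"
    and "g3 G = 3"
  shows "packing_colorable G [2, 2, 2, 2, 2]"
proof -
  interpret graph G by fact
  have "triangular_graph (verts G) (\<lambda>u v. u \<rightarrow>\<^bsub>G\<^esub> v)"
  proof
    show "finite (verts G)" by simp
  next
    fix u v assume "u \<rightarrow>\<^bsub>G\<^esub> v"
    then show "u \<in> verts G" "v \<rightarrow>\<^bsub>G\<^esub> u" using graph_symmetric by (auto simp: adj_in_verts)
  next
    fix v show "\<not> v \<rightarrow>\<^bsub>G\<^esub> v" by (auto simp: arcs_ends_conv dest: no_loops)
    show "card (nbrs (\<lambda>u w. u \<rightarrow>\<^bsub>G\<^esub> w) v) \<le> 3"
    \<comment> \<open>The locale bounds the degree of every element of the type; those outside the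
      graph have no neighbors.\<close>
    proof (cases "v \<in> verts G")
      case True
      then show ?thesis using assms(2) by (simp add: subcubic_def out_degree_eq_card_nbrs)
    next
      case False
      then have "nbrs (\<lambda>u w. u \<rightarrow>\<^bsub>G\<^esub> w) v = {}" using adj_in_verts by blast
      then show ?thesis by (metis card.empty zero_le)
    qed
  next
    fix v assume c: "card (nbrs (\<lambda>u w. u \<rightarrow>\<^bsub>G\<^esub> w) v) = 3"
    then have "nbrs (\<lambda>u w. u \<rightarrow>\<^bsub>G\<^esub> w) v \<noteq> {}" by (metis card.empty zero_neq_numeral)
    then have v: "v \<in> verts G" "out_degree G v = 3"
      using c by (auto simp: out_degree_eq_card_nbrs adj_in_verts)
    then have "local_girth G v \<le> g3 G" unfolding g3_def by (intro SUP_upper) auto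
    then show "\<exists>x y. v \<rightarrow>\<^bsub>G\<^esub> x \<and> v \<rightarrow>\<^bsub>G\<^esub> y \<and> x \<rightarrow>\<^bsub>G\<^esub> y"
      using assms(4) by (intro local_girth_le_3_imp_triangle) simp
    show "\<exists>u. v \<rightarrow>\<^bsub>G\<^esub> u \<and> card (nbrs (\<lambda>u w. u \<rightarrow>\<^bsub>G\<^esub> w) u) \<noteq> 3"
    proof (rule ccontr)
      assume "\<not> ?thesis"
      \<comment> \<open>If all neighbors of \<open>v\<close> had degree 3, the set bounded by
        2-saturation would be the whole neighborhood, which has 3 elements.\<close>
      then have "nbrs (\<lambda>u w. u \<rightarrow>\<^bsub>G\<^esub> w) v = {u \<in> verts G. v \<rightarrow>\<^bsub>G\<^esub> u \<and> out_degree G u = 3}"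
        by (auto simp: out_degree_eq_card_nbrs adj_in_verts)
      then show False using assms(3) v c by (auto simp: saturated_def)
    qed
  qed
  then have "packing_colorable G (replicate 5 2)"
    by (intro square_colorable_imp_packing_colorable triangular_graph_square_colorable)
  then show ?thesis by (simp add: numeral_eq_Suc)
qed

end
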